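(* Let $0<p<1$ and $q=1-p$. For every $n\ge 1$, the expected number $E_n(o(\pi))$ of napkinless guests at a circular table for $n$ people is $$E_n\big(o(\pi)\big)=\frac{n}{pq}\big(1-p\exp_n(q)-q\exp_n(p)+pq\exp_n(1)\big),$$ where $\exp_n(x)=\sum_{k=0}^n x^k/k!$ is the truncated exponential function.
   Context: Circular table model. There are $n$ places labelled $1,\dots,n$ counter-clockwise around a circular table; place $i-1$ is to the left of place $i$ and place $i+1$ is to its right (indices cyclic). There are $n$ napkins, exactly one between each pair of cyclically consecutive places, so each place has a left napkin and a right napkin (for $n=1$ these are the same single napkin). The guests sit down one at a time in uniformly random order. Independently, each guest prefers the left napkin with probability $p$ and the right napkin with probability $q=1-p$. On sitting down, a guest takes his preferred napkin if it is available; otherwise he takes the other adjacent napkin if that one is available; otherwise he gets no napkin (he is napkinless). The order and the preferences are encoded by a signed permutation $\pi$ of $\{1,\dots,n\}$: $|\pi(i)|$ is the arrival rank of the guest at place $i$, and the sign of $\pi(i)$ is negative if that guest prefers left and positive if he prefers right. Let $\mathcal{C}_n$ be the set of all signed permutations of $\{1,\dots,n\}$, let $|\pi|_-$ and $|\pi|_+$ be the numbers of negative and positive entries of $\pi$, and let $o(\pi)$ be the number of napkinless guests. Then $$E_n\big(o(\pi)\big)=\frac{1}{n!}\sum_{\pi\in\mathcal{C}_n}p^{|\pi|_-}q^{|\pi|_+}\,o(\pi).$$ *)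

theory Defs
  imports Complex_Main "HOL-Library.FuncSet"
begin

text \<open>
  Places and napkins are both numbered \<open>1, \<dots>, n\<close>. Napkin \<open>i\<close> lies to the left of place \<open>i\<close>,
  i.e. between place \<open>i\<close> and its cyclic predecessor. For \<open>n = 1\<close> both napkins of place \<open>1\<close>
  coincide.
\<close>

definition left_napkin :: "nat \<Rightarrow> nat \<Rightarrow> nat" where
  "left_napkin n i = i"

definition right_napkin :: "nat \<Rightarrow> nat \<Rightarrow> nat" where
  "right_napkin n i = i mod n + 1"

text \<open>
  \<open>\<bar>\<pi> i\<bar>\<close> is the arrival rank of the guest at place \<open>i\<close>; a negative sign means that this guest
  prefers the left napkin, a positive one the right napkin.
  Functions are pinned to \<open>undefined\<close> outside \<open>{1..n}\<close>, so that each signed permutation is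
  counted exactly once.
\<close>

definition signed_perms :: "nat \<Rightarrow> (nat \<Rightarrow> int) set" where
  "signed_perms n =
     {\<pi> \<in> extensional {1..n}. bij_betw (\<lambda>i. nat \<bar>\<pi> i\<bar>) {1..n} {1..n}}"

definition neg_count :: "nat \<Rightarrow> (nat \<Rightarrow> int) \<Rightarrow> nat" where
  "neg_count n \<pi> = card {i \<in> {1..n}. \<pi> i < 0}"

definition pos_count :: "nat \<Rightarrow> (nat \<Rightarrow> int) \<Rightarrow> nat" where
  "pos_count n \<pi> = card {i \<in> {1..n}. \<pi> i > 0}"

definition place_of_rank :: "nat \<Rightarrow> (nat \<Rightarrow> int) \<Rightarrow> nat \<Rightarrow> nat" where
  "place_of_rank n \<pi> k = inv_into {1..n} (\<lambda>i. nat \<bar>\<pi> i\<bar>) k"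

definition preferred_napkin :: "nat \<Rightarrow> (nat \<Rightarrow> int) \<Rightarrow> nat \<Rightarrow> nat" where
  "preferred_napkin n \<pi> i = (if \<pi> i < 0 then left_napkin n i else right_napkin n i)"

definition other_napkin :: "nat \<Rightarrow> (nat \<Rightarrow> int) \<Rightarrow> nat \<Rightarrow> nat" where
  "other_napkin n \<pi> i = (if \<pi> i < 0 then right_napkin n i else left_napkin n i)"

definition napkin_choice :: "nat \<Rightarrow> (nat \<Rightarrow> int) \<Rightarrow> nat set \<Rightarrow> nat \<Rightarrow> nat option" where
  "napkin_choice n \<pi> A i =
     (if preferred_napkin n \<pi> i \<in> A then Some (preferred_napkin n \<pi> i)
      else if other_napkin n \<pi> i \<in> A then Some (other_napkin n \<pi> i)
      else None)"

text \<open>\<open>available n \<pi> k\<close> is the set of napkins left over after the first \<open>k\<close> arrivals.\<close>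

primrec available :: "nat \<Rightarrow> (nat \<Rightarrow> int) \<Rightarrow> nat \<Rightarrow> nat set" where
  "available n \<pi> 0 = {1..n}"
| "available n \<pi> (Suc k) =
     available n \<pi> k -
       set_option (napkin_choice n \<pi> (available n \<pi> k) (place_of_rank n \<pi> (Suc k)))"

definition napkinless :: "nat \<Rightarrow> (nat \<Rightarrow> int) \<Rightarrow> nat \<Rightarrow> bool" where
  "napkinless n \<pi> i \<longleftrightarrow> napkin_choice n \<pi> (available n \<pi> (nat \<bar>\<pi> i\<bar> - 1)) i = None"

definition num_napkinless :: "nat \<Rightarrow> (nat \<Rightarrow> int) \<Rightarrow> nat" where
  "num_napkinless n \<pi> = card {i \<in> {1..n}. napkinless n \<pi> i}"

text \<open>
  A fixed signed permutation has probability \<open>1 / n!\<close> for the arrival order, times a factor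
  \<open>p\<close> for each guest preferring left and \<open>1 - p\<close> for each guest preferring right.
\<close>

definition expected_napkinless :: "real \<Rightarrow> nat \<Rightarrow> real" where
  "expected_napkinless p n =
     1 / fact n *
       (\<Sum>\<pi>\<in>signed_perms n.
          p ^ neg_count n \<pi> * (1 - p) ^ pos_count n \<pi> * real (num_napkinless n \<pi>))"

definition exp_trunc :: "nat \<Rightarrow> real \<Rightarrow> real" where
  "exp_trunc n x = (\<Sum>k=0..n. x ^ k / fact k)"

lemma finite_signed_perms: "finite (signed_perms n)"
proof (rule finite_subset)
  show "signed_perms n \<subseteq> {1..n} \<rightarrow>\<^sub>E {- int n..int n}"
  proof
    fix \<pi> assume "\<pi> \<in> signed_perms n"
    then have ext: "\<pi> \<in> extensional {1..n}"
      and bij: "bij_betw (\<lambda>i. nat \<bar>\<pi> i\<bar>) {1..n} {1..n}"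
      by (auto simp: signed_perms_def)
    have "\<pi> i \<in> {- int n..int n}" if "i \<in> {1..n}" for i
      using bij_betwE[OF bij] that by fastforce
    with ext show "\<pi> \<in> {1..n} \<rightarrow>\<^sub>E {- int n..int n}"
      by (auto simp: PiE_def)
  qed
qed (intro finite_PiE; simp)

end

theory Submission
  imports Defs "HOL-Combinatorics.Multiset_Permutations"
begin

text \<open>
  By linearity it suffices to find the probability that the guest at a fixed place \<open>i\<close> gets no
  napkin. Both napkins of \<open>i\<close> must be taken before \<open>i\<close> sits down, the left one by the left
  neighbour and the right one by the right neighbour. A left neighbour takes his right napkin
  either because he prefers it, or because he prefers his left one and \<^emph>\<open>his\<close> left neighbour took
  that earlier. Unrolling this recursion (\<open>pushed_chain\<close>) shows that the left napkin of \<open>i\<close> is lost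
  iff for some \<open>a \<ge> 1\<close> the arrival ranks decrease along the places \<open>i, i - 1, \<dots>, i - a\<close>, guest
  \<open>i - a\<close> prefers right, and the guests strictly in between prefer left; the mirror image with some
  \<open>b \<ge> 1\<close> describes the loss of the right napkin (\<open>napkinless_iff_ex\<close>). The numbers \<open>a\<close> and \<open>b\<close>
  are determined by the preferences, and the two chains cannot meet around the table, so that
  \<open>a + b < n\<close> (\<open>squeeze_disjoint\<close>).

  For given \<open>a\<close> and \<open>b\<close>, arrival order and preferences are independent. The preferences fix \<open>a\<close>
  guests to left and \<open>b\<close> guests to right, which has probability \<open>p\<^sup>a q\<^sup>b\<close>. The order makes \<open>i\<close>
  the last of \<open>a + b + 1\<close> guests and prescribes the order within each chain, so the two chains may
  be shuffled freely: this has probability \<open>(a + b choose a) / (a + b + 1)!\<close>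
  (\<open>card_permutations_two_chains\<close>, \<open>weighted_squeeze_count\<close>).

  Summing over \<open>a, b \<ge> 1\<close> with \<open>a + b = m\<close> gives \<open>(1 - p\<^sup>m - q\<^sup>m) / (m + 1)!\<close> by the binomial
  theorem, and summing over \<open>m < n\<close> gives the truncated exponentials (\<open>squeeze_series\<close>).
\<close>

section \<open>Permutations that decrease along given lists\<close>

abbreviation decreasing_along :: "('a \<Rightarrow> 'b::linorder) \<Rightarrow> 'a list \<Rightarrow> bool" where
  "decreasing_along \<sigma> \<equiv> sorted_wrt (\<lambda>x y. \<sigma> y < \<sigma> x)"

lemma decreasing_along_unique:
  assumes "decreasing_along \<sigma> xs" "decreasing_along \<sigma> ys" "set xs = set ys"
  shows "xs = ys"
proof -
  have *: "sorted (map \<sigma> (rev zs)) \<and> distinct (map \<sigma> (rev zs))" if "decreasing_along \<sigma> zs" for zs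
    using that by (induction zs) (auto simp: sorted_append less_imp_le)
  have "inj_on \<sigma> (set xs)"
    using *[OF assms(1)] by (simp add: distinct_map)
  then have "rev xs = rev ys"
    using * assms by (intro map_sorted_distinct_set_unique[of \<sigma>]) auto
  then show ?thesis by simp
qed

lemma ex_decreasing_along:
  assumes "finite S" "inj_on \<sigma> S"
  shows "\<exists>xs. decreasing_along \<sigma> xs \<and> distinct xs \<and> set xs = S"
proof -
  define xs where "xs = rev (map (the_inv_into S \<sigma>) (sorted_list_of_set (\<sigma> ` S)))"
  have set: "set xs = S"
    using assms by (auto simp: xs_def image_image the_inv_into_f_f)
  have "sorted_wrt (<) (sorted_list_of_set (\<sigma> ` S))" by simp
  then have "sorted_wrt (\<lambda>x y. \<sigma> (the_inv_into S \<sigma> x) < \<sigma> (the_inv_into S \<sigma> y))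
      (sorted_list_of_set (\<sigma> ` S))"
    by (rule sorted_wrt_mono_rel[rotated]) (use assms in \<open>auto simp: f_the_inv_into_f\<close>)
  then have dec: "decreasing_along \<sigma> xs"
    by (simp add: xs_def sorted_wrt_rev sorted_wrt_map)
  have "distinct xs"
    using dec by (induction xs) auto
  with set dec show ?thesis by blast
qed

lemma permutation_between_lists:
  assumes "distinct xs" "distinct ys" "set xs = set ys"
  obtains \<tau> where "\<tau> permutes set xs" "map \<tau> xs = ys"
proof
  have len: "length xs = length ys"
    using assms distinct_card by metis
  show "permutation_of_list (zip xs ys) permutes set xs"
    by (rule permutation_of_list_permutes) (use assms len in \<open>auto simp: list_permutes_def\<close>)
  show "map (permutation_of_list (zip xs ys)) xs = ys"
    using assms len
    by (intro nth_equalityI) (auto simp: permutation_of_list_def map_of_zip_nth)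
qed

text \<open>
  By symmetry each of the \<open>k!\<close> orderings of the \<open>k\<close> listed elements is the decreasing one for
  equally many permutations of \<open>A\<close>, and for every permutation exactly one ordering is decreasing.
\<close>

lemma card_permutations_decreasing_along:
  fixes A :: "'a::linorder set"
  assumes "finite A" "distinct xs" "set xs \<subseteq> A"
  shows "fact (length xs) * card {\<sigma>. \<sigma> permutes A \<and> decreasing_along \<sigma> xs} = fact (card A)"
proof -
  let ?C = "\<lambda>ys. {\<sigma>. \<sigma> permutes A \<and> decreasing_along \<sigma> ys}"
  let ?Y = "permutations_of_set (set xs)"
  have fin: "finite (?C ys)" for ys
    by (rule finite_subset[OF _ finite_permutations[OF assms(1)]]) auto
  have eq: "card (?C ys) = card (?C xs)" if "ys \<in> ?Y" for ys
  proof -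
    have ys: "distinct ys" "set xs = set ys" using that by (auto simp: permutations_of_set_def)
    obtain \<tau> where \<tau>: "\<tau> permutes set xs" "map \<tau> xs = ys"
      using permutation_between_lists[OF assms(2) ys] by blast
    have \<tau>A: "\<tau> permutes A" using permutes_subset[OF \<tau>(1) assms(3)] .
    have dec: "decreasing_along \<sigma> ys = decreasing_along (\<sigma> \<circ> \<tau>) xs" for \<sigma> :: "'a \<Rightarrow> 'a"
      by (simp flip: \<tau>(2) add: sorted_wrt_map)
    \<comment> \<open>Relabelling the elements of \<open>A\<close> by \<open>\<tau>\<close> turns the order of \<open>ys\<close> into that of \<open>xs\<close>.\<close>
    have "bij_betw (\<lambda>\<sigma>. \<sigma> \<circ> \<tau>) (?C ys) (?C xs)"
    proof (rule bij_betw_byWitness[where f' = "\<lambda>\<sigma>. \<sigma> \<circ> inv \<tau>"])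
      show "\<forall>\<sigma>\<in>?C ys. \<sigma> \<circ> \<tau> \<circ> inv \<tau> = \<sigma>" "\<forall>\<sigma>\<in>?C xs. \<sigma> \<circ> inv \<tau> \<circ> \<tau> = \<sigma>"
        using permutes_inv_o[OF \<tau>A] by (auto simp: o_assoc[symmetric])
      show "(\<lambda>\<sigma>. \<sigma> \<circ> \<tau>) ` ?C ys \<subseteq> ?C xs"
        using permutes_compose[OF \<tau>A] dec by auto
      show "(\<lambda>\<sigma>. \<sigma> \<circ> inv \<tau>) ` ?C xs \<subseteq> ?C ys"
        using permutes_compose[OF permutes_inv[OF \<tau>A]] dec permutes_inverses[OF \<tau>A]
        by auto
    qed
    then show ?thesis by (rule bij_betw_same_card)
  qed
  have "(\<Union>ys\<in>?Y. ?C ys) = {\<sigma>. \<sigma> permutes A}"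
  proof -
    have "\<exists>ys\<in>?Y. decreasing_along \<sigma> ys" if "\<sigma> permutes A" for \<sigma>
      using ex_decreasing_along[of "set xs" \<sigma>] inj_on_subset[OF permutes_inj_on[OF that, of UNIV]]
      by (auto simp: permutations_of_set_def)
    then show ?thesis by blast
  qed
  then have "fact (card A) = card (\<Union>ys\<in>?Y. ?C ys)"
    using card_permutations[OF refl assms(1)] by simp
  also have "\<dots> = (\<Sum>ys\<in>?Y. card (?C ys))"
  proof (intro card_UN_disjoint ballI impI fin)
    fix ys ys' assume "ys \<in> ?Y" "ys' \<in> ?Y" "ys \<noteq> ys'"
    then show "?C ys \<inter> ?C ys' = {}"
      using decreasing_along_unique[of _ ys ys'] by (auto simp: permutations_of_set_def)
  qed simp
  also have "\<dots> = (\<Sum>ys\<in>?Y. card (?C xs))"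
    by (rule sum.cong) (use eq in auto)
  also have "\<dots> = fact (length xs) * card (?C xs)"
    by (simp add: distinct_card[OF assms(2)])
  finally show ?thesis by simp
qed

text \<open>
  Merging two decreasing lists yields a decreasing shuffle of them; conversely both lists are
  sublists of any of their shuffles and inherit its monotonicity.
\<close>

lemma decreasing_along_shuffle:
  assumes "distinct (xs @ ys)" "inj_on \<sigma> (set xs \<union> set ys)"
  shows "decreasing_along \<sigma> xs \<and> decreasing_along \<sigma> ys \<longleftrightarrow>
    (\<exists>zs\<in>shuffles xs ys. decreasing_along \<sigma> zs)"
proof
  assume dec: "decreasing_along \<sigma> xs \<and> decreasing_along \<sigma> ys"
  obtain zs where zs: "decreasing_along \<sigma> zs" "set zs = set xs \<union> set ys"
    using ex_decreasing_along[OF _ assms(2)] by auto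
  have "filter (\<lambda>x. x \<in> set xs) zs = xs" "filter (\<lambda>x. x \<notin> set xs) zs = ys"
    using zs dec assms(1)
    by (auto intro!: decreasing_along_unique[of \<sigma>] sorted_wrt_filter)
  then have "zs \<in> shuffles xs ys"
    using partition_in_shuffles[of zs "\<lambda>x. x \<in> set xs"] by simp
  with zs show "\<exists>zs\<in>shuffles xs ys. decreasing_along \<sigma> zs" by blast
next
  assume "\<exists>zs\<in>shuffles xs ys. decreasing_along \<sigma> zs"
  then obtain zs where zs: "zs \<in> shuffles xs ys" "decreasing_along \<sigma> zs" by blast
  have "filter (\<lambda>x. x \<in> set xs) zs = xs" "filter (\<lambda>x. x \<notin> set xs) zs = ys"
    using filter_shuffles_disjoint1[OF _ zs(1)] assms(1) by auto
  then show "decreasing_along \<sigma> xs \<and> decreasing_along \<sigma> ys"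
    using sorted_wrt_filter[OF zs(2)] by metis
qed

text \<open>
  The number of permutations for which \<open>z\<close> is the top of two chains that descend independently.
  Every such permutation is decreasing along \<open>z\<close> followed by exactly one shuffle of the chains.
\<close>

lemma card_permutations_two_chains:
  fixes A :: "'a::linorder set"
  assumes "finite A" "distinct (z # xs @ ys)" "set (z # xs @ ys) \<subseteq> A"
  shows "fact (length xs + length ys + 1) *
      card {\<sigma>. \<sigma> permutes A \<and> decreasing_along \<sigma> (z # xs) \<and> decreasing_along \<sigma> (z # ys)} =
    (length xs + length ys choose length xs) * fact (card A)"
proof -
  let ?C = "\<lambda>zs. {\<sigma>. \<sigma> permutes A \<and> decreasing_along \<sigma> (z # zs)}"
  have fin: "finite (?C zs)" for zs
    by (rule finite_subset[OF _ finite_permutations[OF assms(1)]]) auto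
  have "decreasing_along \<sigma> (z # xs) \<and> decreasing_along \<sigma> (z # ys) \<longleftrightarrow>
      (\<exists>zs\<in>shuffles xs ys. decreasing_along \<sigma> (z # zs))" if "\<sigma> permutes A" for \<sigma>
  proof -
    have "decreasing_along \<sigma> xs \<and> decreasing_along \<sigma> ys \<longleftrightarrow>
        (\<exists>zs\<in>shuffles xs ys. decreasing_along \<sigma> zs)"
      using assms(2) inj_on_subset[OF permutes_inj_on[OF that, of UNIV]]
      by (intro decreasing_along_shuffle) auto
    moreover have "set zs = set xs \<union> set ys" if "zs \<in> shuffles xs ys" for zs
      using set_shuffles[OF that] .
    ultimately show ?thesis by (simp add: ball_Un) metis
  qed
  then have "{\<sigma>. \<sigma> permutes A \<and> decreasing_along \<sigma> (z # xs) \<and> decreasing_along \<sigma> (z # ys)} =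
      (\<Union>zs\<in>shuffles xs ys. ?C zs)"
    by blast
  also have "card \<dots> = (\<Sum>zs\<in>shuffles xs ys. card (?C zs))"
  proof (intro card_UN_disjoint ballI impI fin)
    fix zs zs' assume *: "zs \<in> shuffles xs ys" "zs' \<in> shuffles xs ys" "zs \<noteq> zs'"
    then have "set zs = set zs'" by (simp add: set_shuffles)
    then show "?C zs \<inter> ?C zs' = {}"
      using *(3) decreasing_along_unique by fastforce
  qed simp
  finally have "fact (length xs + length ys + 1) *
      card {\<sigma>. \<sigma> permutes A \<and> decreasing_along \<sigma> (z # xs) \<and> decreasing_along \<sigma> (z # ys)} =
    (\<Sum>zs\<in>shuffles xs ys. fact (length xs + length ys + 1) * card (?C zs))"
    by (simp only: sum_distrib_left)
  also have "\<dots> = (\<Sum>zs\<in>shuffles xs ys. fact (card A))"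
  proof (rule sum.cong[OF refl])
    fix zs assume zs: "zs \<in> shuffles xs ys"
    have "distinct (z # zs)" "set (z # zs) \<subseteq> A"
      using assms(2,3) set_shuffles[OF zs] distinct_disjoint_shuffles[OF _ _ _ zs] by auto
    from card_permutations_decreasing_along[OF assms(1) this]
    show "fact (length xs + length ys + 1) * card (?C zs) = fact (card A)"
      by (simp add: length_shuffles[OF zs])
  qed
  also have "\<dots> = (length xs + length ys choose length xs) * fact (card A)"
    using assms(2) by (simp add: card_disjoint_shuffles)
  finally show ?thesis .
qed

lemma decreasing_along_map_upt:
  "decreasing_along f (map g [0..<Suc a]) \<longleftrightarrow> (\<forall>d<a. f (g (Suc d)) < f (g d))"
proof -
  have "transp (\<lambda>x y. f y < f x)" by (auto simp: transp_def)
  then show ?thesis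
    by (simp add: sorted_wrt_iff_nth_Suc_transp nth_append del: upt_Suc)
qed

section \<open>Independent preferences\<close>

text \<open>
  If every element of \<open>S\<close> is put into a random set \<open>N\<close> independently with probability \<open>p\<close>, then
  this is the probability that \<open>N\<close> contains \<open>A\<close> and avoids \<open>B\<close>.
\<close>

lemma sum_subsets_fixed_part:
  fixes p q :: "'c::comm_semiring_1"
  assumes "finite S" "A \<subseteq> S" "B \<subseteq> S" "A \<inter> B = {}" "p + q = 1"
  shows "(\<Sum>N\<in>Pow S. if A \<subseteq> N \<and> B \<inter> N = {} then p ^ card N * q ^ card (S - N) else 0) =
    p ^ card A * q ^ card B"
proof -
  \<comment> \<open>Setting the weight of the forbidden choices to \<open>0\<close> encodes the side condition in a product.\<close>
  let ?f = "\<lambda>x. if x \<in> B then 0 else p" and ?g = "\<lambda>x. if x \<in> A then 0 else q"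
  have "(\<Sum>N\<in>Pow S. if A \<subseteq> N \<and> B \<inter> N = {} then p ^ card N * q ^ card (S - N) else 0) =
      (\<Sum>N\<in>Pow S. prod ?f N * prod ?g (S - N))"
  proof (rule sum.cong[OF refl])
    fix N assume N: "N \<in> Pow S"
    then have finN: "finite N" "finite (S - N)" using assms(1) finite_subset by auto
    show "(if A \<subseteq> N \<and> B \<inter> N = {} then p ^ card N * q ^ card (S - N) else 0) =
        prod ?f N * prod ?g (S - N)"
    proof (cases "A \<subseteq> N \<and> B \<inter> N = {}")
      case True
      have "prod ?f N = (\<Prod>x\<in>N. p)"
        by (rule prod.cong) (use True in auto)
      moreover have "prod ?g (S - N) = (\<Prod>x\<in>S - N. q)"
        by (rule prod.cong) (use True in auto)
      ultimately show ?thesis using True by simp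
    next
      case False
      then consider x where "x \<in> A" "x \<in> S - N" | x where "x \<in> B" "x \<in> N"
        using assms(2) by blast
      then have "prod ?f N = 0 \<or> prod ?g (S - N) = 0"
      proof cases
        case 1
        then show ?thesis by (intro disjI2 prod_zero[OF finN(2)] bexI[of _ x]) auto
      next
        case 2
        then show ?thesis by (intro disjI1 prod_zero[OF finN(1)] bexI[of _ x]) auto
      qed
      then show ?thesis unfolding if_not_P[OF False] by (elim disjE) simp_all
    qed
  qed
  also have "\<dots> = (\<Prod>x\<in>S. ?f x + ?g x)"
    by (rule prod_add[OF assms(1), symmetric])
  also have "\<dots> = (\<Prod>x\<in>S. (if x \<in> A then p else 1) * (if x \<in> B then q else 1))"
    using assms(4,5) by (intro prod.cong) auto
  also have "\<dots> = (\<Prod>x\<in>S \<inter> A. p) * (\<Prod>x\<in>S \<inter> B. q)"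
    unfolding prod.distrib prod.inter_restrict[OF assms(1)] ..
  also have "\<dots> = p ^ card A * q ^ card B"
    using assms(2,3) by (simp add: Int_absorb1)
  finally show ?thesis .
qed

section \<open>Chains of displaced guests\<close>

text \<open>
  Here \<open>c\<close> counts places away from a fixed guest, in one direction. \<open>r c\<close> is the arrival rank at
  distance \<open>c\<close>, \<open>T c\<close> says that the guest there takes the napkin facing the fixed guest, and \<open>s c\<close>
  that he prefers this napkin. The recursion unrolls to a chain of guests who each push the next
  one, started by a guest who takes the facing napkin by preference. It ends because the ranks
  decrease.
\<close>

lemma pushed_chain:
  fixes r :: "nat \<Rightarrow> nat"
  assumes step: "\<And>c. r (Suc c) < r c \<Longrightarrow>
    T (Suc c) \<longleftrightarrow> s (Suc c) \<or> (r (Suc (Suc c)) < r (Suc c) \<and> T (Suc (Suc c)))"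
  shows "r (Suc c) < r c \<and> T (Suc c) \<longleftrightarrow>
    (\<exists>a\<ge>1. (\<forall>d<a. r (c + Suc d) < r (c + d)) \<and> s (c + a) \<and> (\<forall>d\<in>{1..<a}. \<not> s (c + d)))"
    (is "?L c \<longleftrightarrow> (\<exists>a\<ge>1. ?R c a)")
proof (induction "r c" arbitrary: c rule: less_induct)
  case less
  show ?case
  proof (cases "r (Suc c) < r c")
    case False
    then show ?thesis by force
  next
    case True
    have shift: "?R c (Suc a) \<longleftrightarrow> ?R (Suc c) a \<and> \<not> s (Suc c)" if "a \<ge> 1" for a
    proof -
      have "(\<forall>d<Suc a. r (c + Suc d) < r (c + d)) \<longleftrightarrow> (\<forall>d<a. r (Suc c + Suc d) < r (Suc c + d))"
        using True by (auto simp: less_Suc_eq_0_disj)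
      moreover have "{1..<Suc a} = insert 1 (Suc ` {1..<a})"
        using that by (auto simp: image_Suc_atLeastLessThan)
      then have "(\<forall>d\<in>{1..<Suc a}. \<not> s (c + d)) \<longleftrightarrow>
          \<not> s (Suc c) \<and> (\<forall>d\<in>{1..<a}. \<not> s (Suc c + d))"
        by (simp only: ball_simps) simp
      ultimately show ?thesis by auto
    qed
    have "?L c \<longleftrightarrow> s (Suc c) \<or> ?L (Suc c)"
      using step[OF True] True by blast
    also have "\<dots> \<longleftrightarrow> s (Suc c) \<or> (\<not> s (Suc c) \<and> (\<exists>a\<ge>1. ?R (Suc c) a))"
      using less[OF True] by blast
    also have "\<dots> \<longleftrightarrow> ?R c 1 \<or> (\<exists>a\<ge>1. ?R c (Suc a))"
    proof -
      have "(\<exists>a\<ge>1. ?R c (Suc a)) \<longleftrightarrow> \<not> s (Suc c) \<and> (\<exists>a\<ge>1. ?R (Suc c) a)"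
        using shift by blast
      moreover have "?R c 1 \<longleftrightarrow> s (Suc c)" using True by simp
      ultimately show ?thesis by blast
    qed
    also have "\<dots> \<longleftrightarrow> (\<exists>a\<ge>1. ?R c a)"
    proof
      assume "\<exists>a\<ge>1. ?R c a"
      then obtain a where a: "a \<ge> 1" "?R c a" by blast
      show "?R c 1 \<or> (\<exists>a\<ge>1. ?R c (Suc a))"
      proof (cases "a = 1")
        case False
        with a(1) obtain a' where "a = Suc a'" "a' \<ge> 1" by (cases a) auto
        with a(2) show ?thesis by blast
      qed (use a in blast)
    qed (meson le_SucI order_refl)
    finally show ?thesis .
  qed
qed

section \<open>Cyclic positions\<close>

text \<open>
  The place that is \<open>k\<close> steps to the right of \<open>i\<close>; negative \<open>k\<close> means steps to the left. Signed
  distances make the left and right halves of the argument mirror images, and the cyclic structure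
  becomes periodicity in \<open>k\<close>.
\<close>

definition place_at :: "nat \<Rightarrow> nat \<Rightarrow> int \<Rightarrow> nat" where
  "place_at n i k = nat ((int i - 1 + k) mod int n) + 1"

lemma place_at_eq_iff:
  "n \<ge> 1 \<Longrightarrow> place_at n i k = place_at n i l \<longleftrightarrow> int n dvd k - l"
proof -
  assume "n \<ge> 1"
  then have "place_at n i k = place_at n i l \<longleftrightarrow> (int i - 1 + k) mod int n = (int i - 1 + l) mod int n"
    by (simp add: place_at_def eq_nat_nat_iff)
  then show ?thesis by (simp add: mod_eq_dvd_iff)
qed

lemma place_at_in: "n \<ge> 1 \<Longrightarrow> place_at n i k \<in> {1..n}"
  using nat_less_iff[of "(int i - 1 + k) mod int n" n] by (simp add: place_at_def Suc_le_eq)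

lemma place_at_0: "i \<in> {1..n} \<Longrightarrow> place_at n i 0 = i"
  by (auto simp: place_at_def)

lemma right_napkin_place_at:
  assumes "n \<ge> 1"
  shows "right_napkin n (place_at n i k) = place_at n i (k + 1)"
proof -
  have int_place: "int (place_at n i l) = (int i - 1 + l) mod int n + 1" for l
    using assms by (simp add: place_at_def)
  have "int (right_napkin n (place_at n i k)) = ((int i - 1 + k) mod int n + 1) mod int n + 1"
    by (simp only: right_napkin_def of_nat_add zmod_int int_place of_nat_1)
  also have "\<dots> = int (place_at n i (k + 1))"
    unfolding int_place mod_add_left_eq by (simp add: add.assoc)
  finally show ?thesis by linarith
qed

lemma inj_on_place_at:
  assumes "n \<ge> 1" "\<And>k l. k \<in> K \<Longrightarrow> l \<in> K \<Longrightarrow> \<bar>k - l\<bar> < int n"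
  shows "inj_on (place_at n i) K"
proof (rule inj_onI)
  fix k l assume *: "k \<in> K" "l \<in> K" "place_at n i k = place_at n i l"
  then have "int n dvd k - l" by (simp add: place_at_eq_iff[OF assms(1)])
  then show "k = l"
    using assms(2)[OF *(1,2)] zdvd_not_zless[of "\<bar>k - l\<bar>" "int n"] by auto
qed

section \<open>Who is left without a napkin\<close>

definition rank :: "(nat \<Rightarrow> int) \<Rightarrow> nat \<Rightarrow> nat" where
  "rank \<pi> i = nat \<bar>\<pi> i\<bar>"

definition choice :: "nat \<Rightarrow> (nat \<Rightarrow> int) \<Rightarrow> nat \<Rightarrow> nat option" where
  "choice n \<pi> i = napkin_choice n \<pi> (available n \<pi> (rank \<pi> i - 1)) i"

lemma napkinless_iff_choice: "napkinless n \<pi> i \<longleftrightarrow> choice n \<pi> i = None"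
  by (simp add: napkinless_def choice_def rank_def)

lemma rank_bij: "\<pi> \<in> signed_perms n \<Longrightarrow> bij_betw (rank \<pi>) {1..n} {1..n}"
  by (simp add: signed_perms_def rank_def[abs_def])

text \<open>
  This replaces the recursion over time by a relation between the choices of individual guests, so
  that the two neighbours of a napkin can be compared directly.
\<close>

lemma available_iff:
  assumes "\<pi> \<in> signed_perms n" "t \<le> n"
  shows "x \<in> available n \<pi> t \<longleftrightarrow>
    x \<in> {1..n} \<and> (\<forall>j\<in>{1..n}. rank \<pi> j \<le> t \<longrightarrow> choice n \<pi> j \<noteq> Some x)"
  using assms(2)
proof (induction t)
  case 0
  have "rank \<pi> j \<ge> 1" if "j \<in> {1..n}" for j
    using bij_betwE[OF rank_bij[OF assms(1)]] that by auto
  then show ?case by fastforce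
next
  case (Suc t)
  note bij = rank_bij[OF assms(1)]
  define j where "j = place_of_rank n \<pi> (Suc t)"
  have j_inv: "j = inv_into {1..n} (rank \<pi>) (Suc t)"
    by (simp add: j_def place_of_rank_def rank_def[abs_def])
  have "Suc t \<in> rank \<pi> ` {1..n}"
    using Suc.prems bij by (auto simp: bij_betw_def)
  then have j: "j \<in> {1..n}" "rank \<pi> j = Suc t"
    unfolding j_inv by (rule inv_into_into, rule f_inv_into_f)
  have arrived: "rank \<pi> l \<le> Suc t \<longleftrightarrow> rank \<pi> l \<le> t \<or> l = j" if "l \<in> {1..n}" for l
    using that j bij inj_onD[of "rank \<pi>" "{1..n}" l j] by (auto simp: bij_betw_def le_Suc_eq)
  have "available n \<pi> (Suc t) = available n \<pi> t - set_option (choice n \<pi> j)"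
    using j(2) by (simp add: choice_def flip: j_def)
  then have "x \<in> available n \<pi> (Suc t) \<longleftrightarrow> x \<in> available n \<pi> t \<and> choice n \<pi> j \<noteq> Some x"
    by (cases "choice n \<pi> j") auto
  also have "x \<in> available n \<pi> t \<longleftrightarrow>
      x \<in> {1..n} \<and> (\<forall>l\<in>{1..n}. rank \<pi> l \<le> t \<longrightarrow> choice n \<pi> l \<noteq> Some x)"
    using Suc by simp
  also have "\<dots> \<and> choice n \<pi> j \<noteq> Some x \<longleftrightarrow>
      x \<in> {1..n} \<and> (\<forall>l\<in>{1..n}. rank \<pi> l \<le> t \<or> l = j \<longrightarrow> choice n \<pi> l \<noteq> Some x)"
    using j(1) by blast
  also have "\<dots> \<longleftrightarrow>
      x \<in> {1..n} \<and> (\<forall>l\<in>{1..n}. rank \<pi> l \<le> Suc t \<longrightarrow> choice n \<pi> l \<noteq> Some x)"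
    by (intro conj_cong ball_cong refl) (simp only: arrived)
  finally show ?case .
qed

lemma choice_cases: "choice n \<pi> j \<in> {None, Some j, Some (right_napkin n j)}"
  by (auto simp: choice_def napkin_choice_def preferred_napkin_def other_napkin_def left_napkin_def)

text \<open>
  The left napkin of the guest at \<open>i\<close> is lost to a chain of \<open>a\<close> guests on his left: the outermost
  one takes his right napkin by preference, and each later one finds his preferred left napkin gone
  and takes the right one. \<open>right_squeeze\<close> is the mirror image.
\<close>

definition left_squeeze :: "nat \<Rightarrow> nat \<Rightarrow> (nat \<Rightarrow> int) \<Rightarrow> nat \<Rightarrow> bool" where
  "left_squeeze n i \<pi> a \<longleftrightarrow>
     (\<forall>d<a. rank \<pi> (place_at n i (- int (Suc d))) < rank \<pi> (place_at n i (- int d))) \<and>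
     \<not> \<pi> (place_at n i (- int a)) < 0 \<and>
     (\<forall>d\<in>{1..<a}. \<pi> (place_at n i (- int d)) < 0)"

definition right_squeeze :: "nat \<Rightarrow> nat \<Rightarrow> (nat \<Rightarrow> int) \<Rightarrow> nat \<Rightarrow> bool" where
  "right_squeeze n i \<pi> b \<longleftrightarrow>
     (\<forall>d<b. rank \<pi> (place_at n i (int (Suc d))) < rank \<pi> (place_at n i (int d))) \<and>
     \<pi> (place_at n i (int b)) < 0 \<and>
     (\<forall>d\<in>{1..<b}. \<not> \<pi> (place_at n i (int d)) < 0)"

locale guest_at_table =
  fixes n :: nat and i :: nat and \<pi> :: "nat \<Rightarrow> int"
  assumes \<pi>: "\<pi> \<in> signed_perms n" and i: "i \<in> {1..n}"
begin

abbreviation "r k \<equiv> rank \<pi> (place_at n i k)"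
abbreviation "P k \<equiv> place_at n i k"
abbreviation "took_left k \<equiv> choice n \<pi> (P k) = Some (P k)"
abbreviation "took_right k \<equiv> choice n \<pi> (P k) = Some (P (k + 1))"

lemma n_pos: "n \<ge> 1" using i by auto

lemma places_with_napkin:
  assumes "j \<in> {1..n}" "choice n \<pi> j = Some (P k)"
  shows "j = P k \<or> j = P (k - 1)"
proof -
  have "j = P (int j - int i)"
    using assms(1) by (auto simp: place_at_def)
  then obtain l where j: "j = P l" by blast
  from choice_cases[of n \<pi> j] assms(2) have "P l = P k \<or> P (l + 1) = P k"
    by (auto simp: j right_napkin_place_at[OF n_pos])
  moreover have "P (l + 1) = P k \<longleftrightarrow> P l = P (k - 1)"
    by (simp add: place_at_eq_iff[OF n_pos] algebra_simps)
  ultimately show ?thesis by (auto simp: j)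
qed

lemma available_at_arrival:
  "P k \<in> available n \<pi> (r m - 1) \<longleftrightarrow>
    \<not> (r k < r m \<and> took_left k) \<and> \<not> (r (k - 1) < r m \<and> took_right (k - 1))"
proof -
  have r: "r m \<in> {1..n}"
    using bij_betwE[OF rank_bij[OF \<pi>]] place_at_in[OF n_pos] by blast
  then have "P k \<in> available n \<pi> (r m - 1) \<longleftrightarrow>
      (\<forall>j\<in>{1..n}. rank \<pi> j < r m \<longrightarrow> choice n \<pi> j \<noteq> Some (P k))"
    using place_at_in[OF n_pos, of i k] by (subst available_iff[OF \<pi>]) (auto simp: le_diff_conv2)
  also have "\<dots> \<longleftrightarrow> \<not> (r k < r m \<and> took_left k) \<and> \<not> (r (k - 1) < r m \<and> took_right (k - 1))"
    using places_with_napkin[of _ k] place_at_in[OF n_pos, of i] by fastforce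
  finally show ?thesis .
qed

lemma left_available:
  "P k \<in> available n \<pi> (r k - 1) \<longleftrightarrow> \<not> (r (k - 1) < r k \<and> took_right (k - 1))"
  using available_at_arrival[of k k] by simp

lemma right_available:
  "P (k + 1) \<in> available n \<pi> (r k - 1) \<longleftrightarrow> \<not> (r (k + 1) < r k \<and> took_left (k + 1))"
  using available_at_arrival[of "k + 1" k] by simp

lemma choice_eq:
  "choice n \<pi> (P k) =
    (let L = P k \<in> available n \<pi> (r k - 1); R = P (k + 1) \<in> available n \<pi> (r k - 1) in
     if \<pi> (P k) < 0 then if L then Some (P k) else if R then Some (P (k + 1)) else None
     else if R then Some (P (k + 1)) else if L then Some (P k) else None)"
  by (simp add: choice_def napkin_choice_def preferred_napkin_def other_napkin_def left_napkin_def
      right_napkin_place_at[OF n_pos] Let_def)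

lemma neighbours_differ:
  assumes "r k \<noteq> r l" shows "P k \<noteq> P l"
  using assms by auto

text \<open>
  While the guest to the right of \<open>P k\<close> is absent, the right napkin of \<open>P k\<close> is free, so the guest
  at \<open>P k\<close> fails to take it only if he prefers the left napkin and finds it there.
\<close>

lemma took_right_step:
  assumes "r k < r (k + 1)"
  shows "took_right k \<longleftrightarrow> \<not> \<pi> (P k) < 0 \<or> (r (k - 1) < r k \<and> took_right (k - 1))"
proof -
  have "P k \<noteq> P (k + 1)" using assms neighbours_differ[of k "k + 1"] by simp
  then show ?thesis
    using assms by (simp add: choice_eq[of k] Let_def left_available right_available del: One_nat_def)
qed

lemma took_left_step:
  assumes "r k < r (k - 1)"
  shows "took_left k \<longleftrightarrow> \<pi> (P k) < 0 \<or> (r (k + 1) < r k \<and> took_left (k + 1))"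
proof -
  have "P (k - 1 + 1) \<noteq> P (k - 1)" using assms neighbours_differ[of k "k - 1"] by simp
  then have "P k \<noteq> P (k + 1)" by (auto simp: place_at_eq_iff[OF n_pos])
  then show ?thesis
    using assms by (simp add: choice_eq[of k] Let_def left_available right_available del: One_nat_def)
qed

lemma napkinless_iff_squeezed:
  "napkinless n \<pi> i \<longleftrightarrow>
    (r (- 1) < r 0 \<and> took_right (- 1)) \<and> (r 1 < r 0 \<and> took_left 1)"
proof -
  have "napkinless n \<pi> i \<longleftrightarrow> choice n \<pi> (P 0) = None"
    by (simp add: napkinless_iff_choice place_at_0[OF i])
  also have "\<dots> \<longleftrightarrow> P 0 \<notin> available n \<pi> (r 0 - 1) \<and> P (0 + 1) \<notin> available n \<pi> (r 0 - 1)"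
    by (subst choice_eq) (simp add: Let_def)
  also have "\<dots> \<longleftrightarrow>
      (r (0 - 1) < r 0 \<and> took_right (0 - 1)) \<and> (r (0 + 1) < r 0 \<and> took_left (0 + 1))"
    unfolding left_available right_available not_not ..
  finally show ?thesis by (simp only: diff_0 add_0)
qed

lemma napkinless_iff_ex:
  "napkinless n \<pi> i \<longleftrightarrow> (\<exists>a\<ge>1. left_squeeze n i \<pi> a) \<and> (\<exists>b\<ge>1. right_squeeze n i \<pi> b)"
proof -
  have pred: "- int (Suc c) + 1 = - int c" "- int (Suc c) - 1 = - int (Suc (Suc c))" for c
    by simp_all
  have succ: "int (Suc c) - 1 = int c" "int (Suc c) + 1 = int (Suc (Suc c))" for c
    by simp_all
  have right: "took_right (- int (Suc c)) \<longleftrightarrow> \<not> \<pi> (P (- int (Suc c))) < 0 \<or>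
      (r (- int (Suc (Suc c))) < r (- int (Suc c)) \<and> took_right (- int (Suc (Suc c))))"
    if "r (- int (Suc c)) < r (- int c)" for c
    using took_right_step[of "- int (Suc c)"] that unfolding pred by blast
  have left: "took_left (int (Suc c)) \<longleftrightarrow> \<pi> (P (int (Suc c))) < 0 \<or>
      (r (int (Suc (Suc c))) < r (int (Suc c)) \<and> took_left (int (Suc (Suc c))))"
    if "r (int (Suc c)) < r (int c)" for c
    using took_left_step[of "int (Suc c)"] that unfolding succ by blast
  have "r (- int (Suc 0)) < r (- int 0) \<and> took_right (- int (Suc 0)) \<longleftrightarrow> (\<exists>a\<ge>1. left_squeeze n i \<pi> a)"
    unfolding left_squeeze_def
    by (rule pushed_chain[of "\<lambda>c. r (- int c)" "\<lambda>c. took_right (- int c)"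
        "\<lambda>c. \<not> \<pi> (P (- int c)) < 0" 0, unfolded add_0 not_not])
      (rule right)
  moreover have "r (int (Suc 0)) < r (int 0) \<and> took_left (int (Suc 0)) \<longleftrightarrow> (\<exists>b\<ge>1. right_squeeze n i \<pi> b)"
    unfolding right_squeeze_def
    by (rule pushed_chain[of "\<lambda>c. r (int c)" "\<lambda>c. took_left (int c)"
        "\<lambda>c. \<pi> (P (int c)) < 0" 0, unfolded add_0 not_not])
      (rule left)
  moreover have "int (Suc 0) = 1" "int 0 = 0" "- (0::int) = 0" by simp_all
  ultimately show ?thesis unfolding napkinless_iff_squeezed by (simp only:)
qed

text \<open>
  Suppose the chains met. A place at which they end together would need both preferences. Otherwise
  they share two adjacent places, whose ranks would be ordered in both ways.
\<close>

lemma squeeze_disjoint: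
  assumes "a \<ge> 1" "b \<ge> 1" "left_squeeze n i \<pi> a" "right_squeeze n i \<pi> b"
  shows "a + b < n"
proof -
  have desc: "r (- int (Suc d)) < r (- int d)" if "d < a" for d
    using assms(3) that unfolding left_squeeze_def by blast
  have below: "r (- int (Suc d)) < r 0" if "d < a" for d
    using that
  proof (induction d)
    case 0
    then show ?case using desc[of 0] by simp
  next
    case (Suc d)
    then show ?case using desc[of "Suc d"] by linarith
  qed
  have per: "P (k + int n) = P k" for k by (simp add: place_at_eq_iff[OF n_pos])
  have "P (- int n) = P 0" using per[of "- int n"] by simp
  \<comment> \<open>A left chain that goes all around the table would put \<open>i\<close> before himself.\<close>
  with below[of "n - 1"] n_pos have an: "a < n" by (cases "n - 1 < a") auto
  show ?thesis
  proof (rule ccontr)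
    assume "\<not> a + b < n"
    \<comment> \<open>The outermost place of the left chain, seen from the right of \<open>i\<close>.\<close>
    define c where "c = n - a"
    have c: "1 \<le> c" "c \<le> b" using an \<open>\<not> a + b < n\<close> by (auto simp: c_def)
    have Pc: "P (int c) = P (- int a)" using per[of "- int a"] an by (simp add: c_def)
    have Pc1: "P (int (Suc c)) = P (- int (a - 1))"
      using per[of "- int (a - 1)"] an assms(1) by (simp add: c_def algebra_simps of_nat_diff)
    show False
    proof (cases "c = b")
      case True
      then show False
        using Pc assms(3,4) unfolding left_squeeze_def right_squeeze_def by metis
    next
      case False
      then have "r (int (Suc c)) < r (int c)" using c assms(4) unfolding right_squeeze_def by simp
      then have "r (- int (a - 1)) < r (- int a)" by (simp only: Pc Pc1)
      moreover have "r (- int a) < r (- int (a - 1))"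
        using desc[of "a - 1"] assms(1) by simp
      ultimately show False by simp
    qed
  qed
qed
end

text \<open>
  At most one pair \<open>(a, b)\<close> contributes: \<open>a\<close> is the distance to the first guest on the left who
  prefers right, and similarly for \<open>b\<close>. Pairs are listed by \<open>m = a + b\<close>.
\<close>

lemma napkinless_eq_sum:
  assumes "\<pi> \<in> signed_perms n" "i \<in> {1..n}"
  shows "(of_bool (napkinless n \<pi> i) :: real) =
    (\<Sum>m<n. \<Sum>a\<in>{1..<m}. of_bool (left_squeeze n i \<pi> a \<and> right_squeeze n i \<pi> (m - a)))"
proof -
  have guest: "guest_at_table n i \<pi>" using assms by unfold_locales
  have left_unique: "a = a'" if "left_squeeze n i \<pi> a" "left_squeeze n i \<pi> a'" "a \<ge> 1" "a' \<ge> 1" for a a'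
    using that unfolding left_squeeze_def by (metis atLeastLessThan_iff linorder_neqE_nat)
  have right_unique: "b = b'" if "right_squeeze n i \<pi> b" "right_squeeze n i \<pi> b'" "b \<ge> 1" "b' \<ge> 1" for b b'
    using that unfolding right_squeeze_def by (metis atLeastLessThan_iff linorder_neqE_nat)
  show ?thesis
  proof (cases "napkinless n \<pi> i")
    case False
    then have "\<not> (left_squeeze n i \<pi> a \<and> right_squeeze n i \<pi> (m - a))" if "a \<in> {1..<m}" for m a
    proof -
      have "a \<ge> 1" "m - a \<ge> 1" using that by auto
      with False show ?thesis using guest_at_table.napkinless_iff_ex[OF guest] by blast
    qed
    then have "(\<Sum>m<n. \<Sum>a\<in>{1..<m}. of_bool (left_squeeze n i \<pi> a \<and> right_squeeze n i \<pi> (m - a))) =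
        (\<Sum>m<n. \<Sum>a\<in>{1..<m}. (0::real))"
      by (intro sum.cong refl) simp
    with False show ?thesis by simp
  next
    case True
    then obtain a b where ab: "a \<ge> 1" "b \<ge> 1" "left_squeeze n i \<pi> a" "right_squeeze n i \<pi> b"
      using guest_at_table.napkinless_iff_ex[OF guest] by blast
    have "a + b < n" by (rule guest_at_table.squeeze_disjoint[OF guest ab])
    have *: "left_squeeze n i \<pi> a' \<and> right_squeeze n i \<pi> (m - a') \<longleftrightarrow> m = a + b \<and> a' = a"
      if "a' \<in> {1..<m}" for m a'
    proof
      assume "left_squeeze n i \<pi> a' \<and> right_squeeze n i \<pi> (m - a')"
      then have "a' = a" "m - a' = b" using that ab left_unique right_unique by auto
      with that show "m = a + b \<and> a' = a" by auto
    qed (use ab in auto)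
    have "(\<Sum>m<n. \<Sum>a'\<in>{1..<m}. of_bool (left_squeeze n i \<pi> a' \<and> right_squeeze n i \<pi> (m - a'))) =
        (\<Sum>m<n. \<Sum>a'\<in>{1..<m}. if a' = a then of_bool (m = a + b) else (0::real))"
      by (intro sum.cong refl) (simp add: *)
    also have "\<dots> = (\<Sum>m<n. if m = a + b then 1 else 0)"
      using ab(1,2) by (intro sum.cong refl) (simp add: sum.delta)
    also have "\<dots> = 1" using \<open>a + b < n\<close> by (simp add: sum.delta)
    finally show ?thesis using True by simp
  qed
qed

section \<open>Order and preferences of a signed permutation\<close>

text \<open>
  The signed permutation with arrival order \<open>\<sigma>\<close> and set \<open>N\<close> of guests who prefer left. This splits
  a signed permutation into two independent parts.
\<close>

definition signed :: "nat \<Rightarrow> (nat \<Rightarrow> nat) \<Rightarrow> nat set \<Rightarrow> nat \<Rightarrow> int" where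
  "signed n \<sigma> N = (\<lambda>j. if j \<in> {1..n} then if j \<in> N then - int (\<sigma> j) else int (\<sigma> j) else undefined)"

lemma rank_signed: "j \<in> {1..n} \<Longrightarrow> rank (signed n \<sigma> N) j = \<sigma> j"
  by (simp add: rank_def signed_def)

lemma signed_neg_iff:
  assumes "\<sigma> permutes {1..n}" "j \<in> {1..n}"
  shows "signed n \<sigma> N j < 0 \<longleftrightarrow> j \<in> N" "signed n \<sigma> N j > 0 \<longleftrightarrow> j \<notin> N"
  using permutes_in_image[OF assms(1), of j] assms(2) by (auto simp: signed_def)

lemma signed_in_signed_perms:
  assumes "\<sigma> permutes {1..n}" shows "signed n \<sigma> N \<in> signed_perms n"
proof -
  have "bij_betw (\<lambda>j. nat \<bar>signed n \<sigma> N j\<bar>) {1..n} {1..n} \<longleftrightarrow> bij_betw \<sigma> {1..n} {1..n}"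
    by (intro bij_betw_cong) (use rank_signed in \<open>simp add: rank_def\<close>)
  then show ?thesis
    using permutes_imp_bij[OF assms] by (simp add: signed_perms_def extensional_def signed_def)
qed

lemma bij_betw_signed:
  "bij_betw (\<lambda>(\<sigma>, N). signed n \<sigma> N) ({\<sigma>. \<sigma> permutes {1..n}} \<times> Pow {1..n}) (signed_perms n)"
proof (rule bij_betw_byWitness[where
      f' = "\<lambda>\<pi>. (\<lambda>j. if j \<in> {1..n} then rank \<pi> j else j, {j \<in> {1..n}. \<pi> j < 0})"])
  show "\<forall>x\<in>{\<sigma>. \<sigma> permutes {1..n}} \<times> Pow {1..n}.
      (\<lambda>\<pi>. (\<lambda>j. if j \<in> {1..n} then rank \<pi> j else j, {j \<in> {1..n}. \<pi> j < 0}))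
        ((\<lambda>(\<sigma>, N). signed n \<sigma> N) x) = x"
  proof
    fix x assume "x \<in> {\<sigma>. \<sigma> permutes {1..n}} \<times> Pow {1..n}"
    then obtain \<sigma> N where x: "x = (\<sigma>, N)" and *: "\<sigma> permutes {1..n}" "N \<subseteq> {1..n}" by blast
    have "(\<lambda>j. if j \<in> {1..n} then rank (signed n \<sigma> N) j else j) = \<sigma>"
    proof
      fix j show "(if j \<in> {1..n} then rank (signed n \<sigma> N) j else j) = \<sigma> j"
        using rank_signed[of j n] permutes_not_in[OF *(1), of j] by presburger
    qed
    moreover have "{j \<in> {1..n}. signed n \<sigma> N j < 0} = N"
      using signed_neg_iff(1)[OF *(1)] *(2) by blast
    ultimately show "(\<lambda>\<pi>. (\<lambda>j. if j \<in> {1..n} then rank \<pi> j else j, {j \<in> {1..n}. \<pi> j < 0}))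
        ((\<lambda>(\<sigma>, N). signed n \<sigma> N) x) = x"
      by (simp only: x prod.case)
  qed
  show "\<forall>\<pi>\<in>signed_perms n. (\<lambda>(\<sigma>, N). signed n \<sigma> N)
      (\<lambda>j. if j \<in> {1..n} then rank \<pi> j else j, {j \<in> {1..n}. \<pi> j < 0}) = \<pi>"
    by (auto simp: signed_def rank_def signed_perms_def extensional_def fun_eq_iff)
  show "(\<lambda>(\<sigma>, N). signed n \<sigma> N) ` ({\<sigma>. \<sigma> permutes {1..n}} \<times> Pow {1..n}) \<subseteq> signed_perms n"
    using signed_in_signed_perms by auto
  show "(\<lambda>\<pi>. (\<lambda>j. if j \<in> {1..n} then rank \<pi> j else j, {j \<in> {1..n}. \<pi> j < 0})) ` signed_perms n
      \<subseteq> {\<sigma>. \<sigma> permutes {1..n}} \<times> Pow {1..n}"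
  proof (rule image_subsetI)
    fix \<pi> assume "\<pi> \<in> signed_perms n"
    then have "bij_betw (\<lambda>j. if j \<in> {1..n} then rank \<pi> j else j) {1..n} {1..n}"
      using rank_bij[of \<pi> n] by (subst bij_betw_cong[of _ _ "rank \<pi>"]) auto
    then have "(\<lambda>j. if j \<in> {1..n} then rank \<pi> j else j) permutes {1..n}"
      by (rule bij_imp_permutes) auto
    then show "(\<lambda>j. if j \<in> {1..n} then rank \<pi> j else j, {j \<in> {1..n}. \<pi> j < 0})
        \<in> {\<sigma>. \<sigma> permutes {1..n}} \<times> Pow {1..n}"
      by blast
  qed
qed

lemma sum_signed_perms:
  "(\<Sum>\<pi>\<in>signed_perms n. h \<pi>) =
    (\<Sum>\<sigma> | \<sigma> permutes {1..n}. \<Sum>N\<in>Pow {1..n}. h (signed n \<sigma> N))"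
  by (simp add: sum.reindex_bij_betw[OF bij_betw_signed, symmetric] sum.cartesian_product
      case_prod_unfold)

section \<open>The probability of a pair of chains\<close>

text \<open>
  The two squeezes together are a condition on the order alone and a condition on the preferences
  alone: the inner guests of the left chain and the outermost one of the right chain prefer left,
  all others in the chains prefer right.
\<close>

lemma squeeze_signed_iff:
  assumes "\<sigma> permutes {1..n}" "i \<in> {1..n}" "a \<ge> 1" "b \<ge> 1"
  shows "left_squeeze n i (signed n \<sigma> N) a \<and> right_squeeze n i (signed n \<sigma> N) b \<longleftrightarrow>
    (decreasing_along \<sigma> (i # map (\<lambda>d. place_at n i (- int d)) [1..<Suc a]) \<and>
     decreasing_along \<sigma> (i # map (\<lambda>d. place_at n i (int d)) [1..<Suc b])) \<and>
    (place_at n i ` insert (int b) ((\<lambda>d. - int d) ` {1..<a}) \<subseteq> N \<and>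
     place_at n i ` insert (- int a) (int ` {1..<b}) \<inter> N = {})"
proof -
  have n: "n \<ge> 1" using assms(2) by simp
  note in_table = place_at_in[OF n, of i]
  have chain: "i # map (\<lambda>d. place_at n i (f d)) [1..<Suc c] = map (\<lambda>d. place_at n i (f d)) [0..<Suc c]"
    if "f 0 = 0" for f c
    using that place_at_0[OF assms(2)] by (simp add: upt_conv_Cons del: upt_Suc)
  show ?thesis
    using chain[of "\<lambda>d. - int d"] chain[of int]
    by (simp only: left_squeeze_def right_squeeze_def decreasing_along_map_upt rank_signed[OF in_table]
        signed_neg_iff(1)[OF assms(1) in_table] of_nat_0 minus_zero) blast
qed

text \<open>
  The double sum factorises because \<open>\<sigma>\<close> carries only the order and \<open>N\<close> only the preferences. The
  hypothesis \<open>a + b < n\<close> makes the places of both chains and \<open>i\<close> distinct.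
\<close>

lemma weighted_squeeze_count:
  fixes p q :: real
  assumes "i \<in> {1..n}" "a \<ge> 1" "b \<ge> 1" "a + b < n" "p + q = 1"
  shows "(\<Sum>\<sigma> | \<sigma> permutes {1..n}. \<Sum>N\<in>Pow {1..n}. p ^ card N * q ^ card ({1..n} - N) *
      of_bool (left_squeeze n i (signed n \<sigma> N) a \<and> right_squeeze n i (signed n \<sigma> N) b)) =
    fact n * (real (a + b choose a) * p ^ a * q ^ b / fact (a + b + 1))"
proof -
  have n: "n \<ge> 1" using assms(1) by simp
  let ?P = "place_at n i"
  define xs where "xs = map (\<lambda>d. ?P (- int d)) [1..<Suc a]"
  define ys where "ys = map (\<lambda>d. ?P (int d)) [1..<Suc b]"
  \<comment> \<open>Signed distances from \<open>i\<close> to the guests who must prefer left and right, respectively.\<close>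
  define K L where "K = insert (int b) ((\<lambda>d. - int d) ` {1..<a})"
    and "L = insert (- int a) (int ` {1..<b})"
  have inj: "inj_on ?P {- int a..int b}"
    using assms(4) by (intro inj_on_place_at[OF n]) auto
  have KL: "K \<subseteq> {- int a..int b}" "L \<subseteq> {- int a..int b}" "K \<inter> L = {}"
    using assms(2,3) by (auto simp: K_def L_def)
  have "card K = Suc (card ((\<lambda>d. - int d) ` {1..<a}))"
    unfolding K_def using assms(3) by (intro card_insert_disjoint) auto
  also have "\<dots> = a"
    using assms(2) by (subst card_image) (auto simp: inj_on_def)
  finally have "card K = a" .
  then have card_K: "card (?P ` K) = a"
    using card_image[OF inj_on_subset[OF inj KL(1)]] by simp
  have "card L = Suc (card (int ` {1..<b}))"
    unfolding L_def using assms(2) by (intro card_insert_disjoint) auto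
  also have "\<dots> = b"
    using assms(3) by (subst card_image) (auto simp: inj_on_def)
  finally have "card L = b" .
  then have card_L: "card (?P ` L) = b"
    using card_image[OF inj_on_subset[OF inj KL(2)]] by simp
  have disj: "?P ` K \<inter> ?P ` L = {}"
    using inj_on_image_Int[OF inj KL(1,2)] KL(3) by simp
  have in_table: "?P ` K \<subseteq> {1..n}" "?P ` L \<subseteq> {1..n}"
    using place_at_in[OF n] by blast+
  have "distinct (i # xs @ ys)"
  proof -
    have "i # xs @ ys = map ?P (0 # map (\<lambda>d. - int d) [1..<Suc a] @ map int [1..<Suc b])"
      by (simp add: xs_def ys_def place_at_0[OF assms(1)] del: upt_Suc)
    moreover have "distinct (map ?P (0 # map (\<lambda>d. - int d) [1..<Suc a] @ map int [1..<Suc b]))"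
      unfolding distinct_map
    proof
      show "distinct (0 # map (\<lambda>d. - int d) [1..<Suc a] @ map int [1..<Suc b])"
        by (auto simp: distinct_map inj_on_def simp del: upt_Suc)
      show "inj_on ?P (set (0 # map (\<lambda>d. - int d) [1..<Suc a] @ map int [1..<Suc b]))"
        by (rule inj_on_subset[OF inj]) (auto simp del: upt_Suc)
    qed
    ultimately show ?thesis by (simp only:)
  qed
  moreover have "set (i # xs @ ys) \<subseteq> {1..n}"
    using assms(1) place_at_in[OF n, of i] unfolding xs_def ys_def by (simp add: image_subset_iff del: upt_Suc)
  ultimately have count: "fact (a + b + 1) * card {\<sigma>. \<sigma> permutes {1..n} \<and>
      decreasing_along \<sigma> (i # xs) \<and> decreasing_along \<sigma> (i # ys)} = (a + b choose a) * fact n"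
    using card_permutations_two_chains[of "{1..n}" i xs ys] by (simp add: xs_def ys_def del: upt_Suc)
  have "(\<Sum>\<sigma> | \<sigma> permutes {1..n}. \<Sum>N\<in>Pow {1..n}. p ^ card N * q ^ card ({1..n} - N) *
      of_bool (left_squeeze n i (signed n \<sigma> N) a \<and> right_squeeze n i (signed n \<sigma> N) b)) =
    (\<Sum>\<sigma> | \<sigma> permutes {1..n}. of_bool (decreasing_along \<sigma> (i # xs) \<and> decreasing_along \<sigma> (i # ys)) *
      (\<Sum>N\<in>Pow {1..n}. if ?P ` K \<subseteq> N \<and> ?P ` L \<inter> N = {} then p ^ card N * q ^ card ({1..n} - N) else 0))"
    unfolding sum_distrib_left
    by (intro sum.cong refl)
      (simp add: squeeze_signed_iff[OF _ assms(1-3)] K_def L_def xs_def ys_def del: upt_Suc sorted_wrt.simps)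
  also have "\<dots> = (\<Sum>\<sigma> | \<sigma> permutes {1..n}.
      of_bool (decreasing_along \<sigma> (i # xs) \<and> decreasing_along \<sigma> (i # ys)) * (p ^ a * q ^ b))"
    by (subst sum_subsets_fixed_part) (use assms(5) in_table disj card_K card_L in auto)
  also have "\<dots> = real (card {\<sigma>. \<sigma> permutes {1..n} \<and>
      decreasing_along \<sigma> (i # xs) \<and> decreasing_along \<sigma> (i # ys)}) * (p ^ a * q ^ b)"
    unfolding sum_distrib_right[symmetric]
    by (simp add: finite_permutations flip: Collect_conj_eq del: sorted_wrt.simps)
  also have "\<dots> = fact n * (real (a + b choose a) * p ^ a * q ^ b / fact (a + b + 1))"
    using arg_cong[OF count, of real] by (simp add: field_simps del: sorted_wrt.simps fact_Suc)
  finally show ?thesis .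
qed

section \<open>The expected number of napkinless guests\<close>

text \<open>
  The binomial theorem without its two extreme terms gives \<open>1 - p\<^sup>m - q\<^sup>m\<close> for the inner sum.
  This holds for \<open>m \<ge> 1\<close> only, but the inner sum is empty for \<open>m = 0\<close>, and on the right-hand side
  the terms of the exponential sums up to degree \<open>1\<close> cancel. So both sides vanish for \<open>n = 1\<close>, and the
  term for \<open>m\<close> is what the terms of degree \<open>m + 1\<close> add on the right.
\<close>

lemma squeeze_series:
  fixes p q :: real
  assumes "p + q = 1" "n \<ge> 1"
  shows "p * q * (\<Sum>m<n. \<Sum>a\<in>{1..<m}. real (m choose a) * p ^ a * q ^ (m - a) / fact (m + 1)) =
    1 - p * exp_trunc n q - q * exp_trunc n p + p * q * exp_trunc n 1"
  using assms(2)
proof (induction n rule: dec_induct)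
  case base
  have q: "q = 1 - p" using assms(1) by simp
  have "exp_trunc 1 x = 1 + x" for x
    by (simp add: exp_trunc_def)
  then show ?case
    unfolding q by (simp add: algebra_simps)
next
  case (step n)
  have "{..n} = insert 0 (insert n {1..<n})" using step.hyps by auto
  then have "(\<Sum>a\<le>n. f a) = f 0 + (f n + (\<Sum>a\<in>{1..<n}. f a))" for f :: "nat \<Rightarrow> real"
    using step.hyps by (simp only:) simp
  from this[of "\<lambda>a. real (n choose a) * p ^ a * q ^ (n - a)"]
  have "(\<Sum>a\<in>{1..<n}. real (n choose a) * p ^ a * q ^ (n - a)) = 1 - p ^ n - q ^ n"
    using binomial_ring[of p q n] assms(1) by simp
  then have inner: "(\<Sum>a\<in>{1..<n}. real (n choose a) * p ^ a * q ^ (n - a) / fact (n + 1)) =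
      (1 - p ^ n - q ^ n) / fact (n + 1)"
    by (simp flip: sum_divide_distrib)
  have exp_Suc: "exp_trunc (Suc n) x = exp_trunc n x + x ^ Suc n / fact (n + 1)" for x
    by (simp add: exp_trunc_def)
  have "p * q * (\<Sum>m<Suc n. \<Sum>a\<in>{1..<m}. real (m choose a) * p ^ a * q ^ (m - a) / fact (m + 1)) =
      (1 - p * exp_trunc n q - q * exp_trunc n p + p * q * exp_trunc n 1) +
      p * q * ((1 - p ^ n - q ^ n) / fact (n + 1))"
    by (simp only: sum.lessThan_Suc inner distrib_left step.IH)
  also have "\<dots> = 1 - p * exp_trunc (Suc n) q - q * exp_trunc (Suc n) p + p * q * exp_trunc (Suc n) 1"
    by (simp add: exp_Suc algebra_simps diff_divide_distrib add_divide_distrib del: fact_Suc)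
  finally show ?case .
qed

lemma weighted_sum_swap:
  fixes w :: "'n \<Rightarrow> 'c::comm_semiring_0"
  shows "(\<Sum>\<sigma>\<in>S. \<Sum>N\<in>T. w N * (\<Sum>i\<in>I. f \<sigma> N i)) = (\<Sum>i\<in>I. \<Sum>\<sigma>\<in>S. \<Sum>N\<in>T. w N * f \<sigma> N i)"
proof -
  have "(\<Sum>\<sigma>\<in>S. \<Sum>N\<in>T. w N * (\<Sum>i\<in>I. f \<sigma> N i)) = (\<Sum>\<sigma>\<in>S. \<Sum>i\<in>I. \<Sum>N\<in>T. w N * f \<sigma> N i)"
    unfolding sum_distrib_left by (intro sum.cong refl sum.swap)
  also have "\<dots> = (\<Sum>i\<in>I. \<Sum>\<sigma>\<in>S. \<Sum>N\<in>T. w N * f \<sigma> N i)"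
    by (rule sum.swap)
  finally show ?thesis .
qed

theorem theorem4:
  fixes p q :: real and n :: nat
  assumes "0 < p" "p < 1" and "q = 1 - p" and "n \<ge> 1"
  shows "expected_napkinless p n =
    real n / (p * q) *
      (1 - p * exp_trunc n q - q * exp_trunc n p + p * q * exp_trunc n 1)"
proof -
  have pq: "p + q = 1" using assms(3) by simp
  let ?S = "{\<sigma>. \<sigma> permutes {1..n}}"
  let ?w = "\<lambda>N. p ^ card N * q ^ card ({1..n} - N)"
  let ?sq = "\<lambda>\<sigma> N i m a. left_squeeze n i (signed n \<sigma> N) a \<and> right_squeeze n i (signed n \<sigma> N) (m - a)"
  let ?T = "\<Sum>m<n. \<Sum>a\<in>{1..<m}. real (m choose a) * p ^ a * q ^ (m - a) / fact (m + 1)"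
  have weight: "p ^ neg_count n (signed n \<sigma> N) * (1 - p) ^ pos_count n (signed n \<sigma> N) = ?w N"
    if "\<sigma> permutes {1..n}" "N \<subseteq> {1..n}" for \<sigma> N
  proof -
    have "{j \<in> {1..n}. signed n \<sigma> N j < 0} = N" "{j \<in> {1..n}. signed n \<sigma> N j > 0} = {1..n} - N"
      using signed_neg_iff[OF that(1)] that(2) by blast+
    then show ?thesis by (simp only: neg_count_def pos_count_def assms(3))
  qed
  have number: "real (num_napkinless n (signed n \<sigma> N)) =
      (\<Sum>i=1..n. \<Sum>m<n. \<Sum>a\<in>{1..<m}. of_bool (?sq \<sigma> N i m a))" if "\<sigma> permutes {1..n}" for \<sigma> N
  proof -
    have "real (num_napkinless n (signed n \<sigma> N)) = (\<Sum>i=1..n. of_bool (napkinless n (signed n \<sigma> N) i))"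
      by (simp add: num_napkinless_def Int_def)
    then show ?thesis
      using napkinless_eq_sum[OF signed_in_signed_perms[OF that]] by simp
  qed
  have "expected_napkinless p n = 1 / fact n *
      (\<Sum>\<sigma>\<in>?S. \<Sum>N\<in>Pow {1..n}. ?w N * (\<Sum>i=1..n. \<Sum>m<n. \<Sum>a\<in>{1..<m}. of_bool (?sq \<sigma> N i m a)))"
    unfolding expected_napkinless_def sum_signed_perms
    by (rule arg_cong[of _ _ "\<lambda>x. 1 / fact n * x"], intro sum.cong refl) (simp add: weight number)
  also have "\<dots> = 1 / fact n * (\<Sum>i=1..n. \<Sum>m<n. \<Sum>a\<in>{1..<m}.
      \<Sum>\<sigma>\<in>?S. \<Sum>N\<in>Pow {1..n}. ?w N * of_bool (?sq \<sigma> N i m a))"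
    by (simp only: weighted_sum_swap)
  also have "\<dots> = 1 / fact n * (\<Sum>i=1..n. \<Sum>m<n. \<Sum>a\<in>{1..<m}.
      fact n * (real (m choose a) * p ^ a * q ^ (m - a) / fact (m + 1)))"
  proof (intro arg_cong2[of _ _ _ _ "(*)"] sum.cong refl)
    fix i m a assume *: "i \<in> {1..n}" "m \<in> {..<n}" "a \<in> {1..<m}"
    then have "a \<ge> 1" "m - a \<ge> 1" "a + (m - a) = m" "m < n" by auto
    then show "(\<Sum>\<sigma>\<in>?S. \<Sum>N\<in>Pow {1..n}. ?w N * of_bool (?sq \<sigma> N i m a)) =
        fact n * (real (m choose a) * p ^ a * q ^ (m - a) / fact (m + 1))"
      using weighted_squeeze_count[OF *(1) _ _ _ pq, of a "m - a"] by (simp only:)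
  qed
  also have "\<dots> = real n * ?T"
    unfolding sum_distrib_left[symmetric] by simp
  also have "\<dots> = real n / (p * q) * (p * q * ?T)"
    using assms(1-3) by simp
  finally show ?thesis unfolding squeeze_series[OF pq assms(4)] .
qed

end
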